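(* Let $G$ be a tournament and $v_1,\ldots,v_n$ a matching ordering of $G$. Suppose $\pi \in S_n$ is a permutation such that $v_{\pi(1)},\ldots,v_{\pi(n)}$ is also a matching ordering of $G$. Then $\{1,\ldots,n\}$ can be partitioned into sets $X_1,\ldots,X_r$, each a set of consecutive integers, such that: (1) $\pi = \sigma_1\sigma_2\cdots\sigma_r$, where for each $i$, $\sigma_i$ is one of $\sigma_{X_i}$, $\sigma_{X_i}^{-1}$, or $\tau_{X_i}$ (the last only when $|X_i|=4$); (2) for each $i$, $V_i=\{v_x : x\in X_i\}$ is a homogeneous set of $G$; (3) for each $i$, the subtournament $H_i$ induced on $V_i$ is either transitive or isomorphic to $P_{|V_i|}$; moreover, writing $X_i=\{b,\dots,a\}$ and $m=|X_i|$, the ordering $v_b,v_{b+1},\dots,v_a$ of $V_i$ satisfies: if $\sigma_i=\sigma_{X_i}$ then $H_i$ is transitive or isomorphic to $P_m$ and this ordering is $\pi_2 H_i$; if $\sigma_i=\sigma_{X_i}^{-1}$ then $H_i$ is transitive or isomorphic to $P_m$ and this ordering is $\pi_1 H_i$; if $\sigma_i=\tau_{X_i}$ then $H_i$ is isomorphic to $P_4$ and this ordering is $\pi_2 H_i$ or $\pi_2\pi_1 H_i$.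
   Context: A tournament is a finite, non-null, loopless directed graph in which for any two distinct vertices $u,v$ there is exactly one edge with both ends in $\{u,v\}$; write $u\to v$ for the edge from $u$ to $v$. A homogeneous set of $G$ is a set $X\subseteq V(G)$ such that each vertex outside $X$ either has edges to all of $X$ or edges from all of $X$. Given an ordering $v_1,\dots,v_n$ of $V(G)$, a backedge is an edge $v_j\to v_i$ with $j>i$; the ordering is a matching ordering if every vertex is the head or tail of at most one backedge. A tournament is transitive if it has an ordering $v_1,\dots,v_n$ with $v_i\to v_j$ whenever $i<j$ (its standard ordering). $P_m$ is the tournament on $v_1,\dots,v_m$ with $v_i\to v_j$ if $j-i\ge2$ and $v_{i+1}\to v_i$ for $1\le i\le m-1$; for $m\ne3$ such a defining ordering is unique. For $X=\{b,b+1,\dots,a\}$: if $|X|$ is odd, $\sigma_X$ is the cycle $(b\ b{+}2\ b{+}4\ \cdots\ a{-}2\ a\ a{-}1\ a{-}3\ \cdots\ b{+}1)$; if $|X|$ is even, $\sigma_X=(b\ b{+}2\ \cdots\ a{-}1\ a\ a{-}2\ \cdots\ b{+}1)$ (so $\sigma_X$ is the identity if $|X|=1$ and the transposition $(b\ a)$ if $|X|=2$), regarded as a permutation of $\{1,\dots,n\}$ fixing everything outside $X$; if $|X|=4$, $\tau_X=(b\ b{+}2)(b{+}1\ b{+}3)$. For a tournament $H$ on $m$ vertices that is transitive or isomorphic to $P_m$, let $u_1,\dots,u_m$ be its standard ordering (if transitive) or its defining $P_m$ ordering (if $m\ne3$), or some defining $P_3$ ordering (if $m=3$); then $\pi_1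 H$ is the ordering $u_2,u_1,u_4,u_3,\dots$ (swap $u_{2j-1},u_{2j}$ for all $j\le \lfloor m/2\rfloor$), $\pi_2 H$ is the ordering $u_1,u_3,u_2,u_5,u_4,\dots$ (swap $u_{2j},u_{2j+1}$ for all $j\le \lfloor m/2\rfloor-1$... i.e. for $1\le j$ with $2j+1\le m$), and for $H\cong P_4$, $\pi_2\pi_1 H$ is the ordering $u_2,u_4,u_1,u_3$. When $m=2$, any ordering counts as $\pi_1H$, $\pi_2H$. *)

theory Defs
  imports "HOL-Combinatorics.Permutations"
begin

text \<open>A tournament on the finite nonempty vertex set V with edge relation E
  (E u v means u \<rightarrow> v). Values of E outside V are irrelevant.\<close>
definition tournament :: "'a set \<Rightarrow> ('a \<Rightarrow> 'a \<Rightarrow> bool) \<Rightarrow> bool" where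
  "tournament V E \<longleftrightarrow> finite V \<and> V \<noteq> {} \<and> (\<forall>u\<in>V. \<not> E u u) \<and>
     (\<forall>u\<in>V. \<forall>w\<in>V. u \<noteq> w \<longrightarrow> (E u w \<longleftrightarrow> \<not> E w u))"

definition homogeneous :: "'a set \<Rightarrow> ('a \<Rightarrow> 'a \<Rightarrow> bool) \<Rightarrow> 'a set \<Rightarrow> bool" where
  "homogeneous V E X \<longleftrightarrow> X \<subseteq> V \<and>
     (\<forall>u\<in>V - X. (\<forall>x\<in>X. E u x) \<or> (\<forall>x\<in>X. E x u))"

definition backedges :: "('a \<Rightarrow> 'a \<Rightarrow> bool) \<Rightarrow> nat \<Rightarrow> (nat \<Rightarrow> 'a) \<Rightarrow> (nat \<times> nat) set" where
  "backedges E n w = {(i, j). 1 \<le> i \<and> i < j \<and> j \<le> n \<and> E (w j) (w i)}"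

definition matching_ordering :: "'a set \<Rightarrow> ('a \<Rightarrow> 'a \<Rightarrow> bool) \<Rightarrow> nat \<Rightarrow> (nat \<Rightarrow> 'a) \<Rightarrow> bool" where
  "matching_ordering V E n w \<longleftrightarrow> bij_betw w {1..n} V \<and>
     (\<forall>k\<in>{1..n}. card {(i, j) \<in> backedges E n w. i = k \<or> j = k} \<le> 1)"

definition standard_trans_ordering :: "('a \<Rightarrow> 'a \<Rightarrow> bool) \<Rightarrow> nat \<Rightarrow> (nat \<Rightarrow> 'a) \<Rightarrow> bool" where
  "standard_trans_ordering E m u \<longleftrightarrow> (\<forall>i j. 1 \<le> i \<and> i < j \<and> j \<le> m \<longrightarrow> E (u i) (u j))"

definition P_ordering :: "('a \<Rightarrow> 'a \<Rightarrow> bool) \<Rightarrow> nat \<Rightarrow> (nat \<Rightarrow> 'a) \<Rightarrow> bool" where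
  "P_ordering E m u \<longleftrightarrow> (\<forall>i\<in>{1..m}. \<forall>j\<in>{1..m}. i \<noteq> j \<longrightarrow>
      (E (u i) (u j) \<longleftrightarrow> (i + 2 \<le> j \<or> i = j + 1)))"

definition trans_or_P :: "('a \<Rightarrow> 'a \<Rightarrow> bool) \<Rightarrow> 'a set \<Rightarrow> nat \<Rightarrow> bool" where
  "trans_or_P E W m \<longleftrightarrow> (\<exists>u. bij_betw u {1..m} W \<and>
      (standard_trans_ordering E m u \<or> P_ordering E m u))"

text \<open>Position permutations: the ordering pi H has, at position k, the vertex u_(p k).\<close>
definition pi1_pos :: "nat \<Rightarrow> nat \<Rightarrow> nat" where
  "pi1_pos m k = (if odd k \<and> k + 1 \<le> m then k + 1 else if even k then k - 1 else k)"

definition pi2_pos :: "nat \<Rightarrow> nat \<Rightarrow> nat" where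
  "pi2_pos m k = (if even k \<and> k + 1 \<le> m then k + 1
                  else if odd k \<and> k \<ge> 3 then k - 1 else k)"

definition pi21_pos :: "nat \<Rightarrow> nat" where
  "pi21_pos k = (if k = 1 then 2 else if k = 2 then 4 else if k = 3 then 1 else 3)"

definition is_pi_ordering ::
  "('a \<Rightarrow> 'a \<Rightarrow> bool) \<Rightarrow> 'a set \<Rightarrow> nat \<Rightarrow> (nat \<Rightarrow> nat) \<Rightarrow> (nat \<Rightarrow> 'a) \<Rightarrow> bool" where
  "is_pi_ordering E W m p w \<longleftrightarrow> (\<exists>u. bij_betw u {1..m} W \<and>
      (standard_trans_ordering E m u \<or> P_ordering E m u) \<and> (\<forall>k\<in>{1..m}. w k = u (p k)))"

definition is_P_pi_ordering ::
  "('a \<Rightarrow> 'a \<Rightarrow> bool) \<Rightarrow> 'a set \<Rightarrow> nat \<Rightarrow> (nat \<Rightarrow> nat) \<Rightarrow> (nat \<Rightarrow> 'a) \<Rightarrow> bool" where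
  "is_P_pi_ordering E W m p w \<longleftrightarrow> (\<exists>u. bij_betw u {1..m} W \<and>
      P_ordering E m u \<and> (\<forall>k\<in>{1..m}. w k = u (p k)))"

text \<open>sigma_X for X = {b..a}, as a permutation of nat fixing everything outside X
  (cycle notation (x y ...) means x \<mapsto> y).\<close>
definition sigmaX :: "nat \<Rightarrow> nat \<Rightarrow> nat \<Rightarrow> nat" where
  "sigmaX b a x =
    (if x < b \<or> a < x then x
     else if even (x - b) then
       (if x + 2 \<le> a then x + 2 else if x + 1 \<le> a then x + 1 else if b < x then x - 1 else x)
     else (if b + 3 \<le> x then x - 2 else x - 1))"

definition tauX :: "nat \<Rightarrow> nat \<Rightarrow> nat" where
  "tauX b x = (if x = b \<or> x = b + 1 then x + 2 else if x = b + 2 \<or> x = b + 3 then x - 2 else x)"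

datatype kind = Sig | SigInv | Tau

definition block_perm :: "kind \<Rightarrow> nat \<Rightarrow> nat \<Rightarrow> nat \<Rightarrow> nat" where
  "block_perm k b a = (case k of Sig \<Rightarrow> sigmaX b a | SigInv \<Rightarrow> inv (sigmaX b a) | Tau \<Rightarrow> tauX b)"

end

theory Submission
  imports Defs
begin

text \<open>A pair of vertices is inverted by \<open>\<pi>\<close> iff it is a backedge in exactly one of the two
  orderings. Hence the inversion graph of \<open>\<pi>\<close> is the symmetric difference of two matchings: it has
  maximum degree at most 2 and no triangle. The only permutations with a connected inversion graph
  of this kind are the identity on one point, \<open>\<sigma>\<close> and its inverse (a path), and \<open>\<tau>\<close> (a 4-cycle),
  and \<open>\<pi>\<close> splits into such blocks on consecutive intervals. Every vertex of a block with at least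
  two elements already has a backedge inside the block in one of the orderings, so no common
  backedge meets the block; this makes the block homogeneous. Along the path, whose vertices are
  read off in the order \<open>\<pi>\<^sub>2\<close> resp. \<open>\<pi>\<^sub>1\<close>, the backedges of the two orderings alternate; the two
  possible alternations give the transitive tournament and \<open>P\<^sub>m\<close>.\<close>

section \<open>Inversion graphs of permutations\<close>

definition inverted :: "(nat \<Rightarrow> nat) \<Rightarrow> nat \<Rightarrow> nat \<Rightarrow> bool" where
  "inverted f x y \<longleftrightarrow> (x < y \<and> f y < f x) \<or> (y < x \<and> f x < f y)"

text \<open>Degree at most 2 is phrased as a coincidence among any three neighbours.
  Triangle-freeness becomes the absence of a decreasing triple, since the triangles of an inversion
  graph are exactly the decreasing triples.\<close>

definition sparse :: "(nat \<Rightarrow> nat) \<Rightarrow> bool" where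
  "sparse f \<longleftrightarrow>
     (\<forall>x y z t. inverted f x y \<and> inverted f x z \<and> inverted f x t \<longrightarrow> y = z \<or> y = t \<or> z = t) \<and>
     (\<forall>x y z. x < y \<and> y < z \<longrightarrow> \<not> (f z < f y \<and> f y < f x))"

lemma sparse_degree:
  "sparse f \<Longrightarrow> inverted f x y \<Longrightarrow> inverted f x z \<Longrightarrow> inverted f x t \<Longrightarrow> y = z \<or> y = t \<or> z = t"
  unfolding sparse_def by blast

lemma inverted_inv:
  assumes "f permutes S"
  shows "inverted (inv f) x y \<longleftrightarrow> inverted f (inv f x) (inv f y)"
  using permutes_inverses(1)[OF assms] unfolding inverted_def by auto

text \<open>The map \<open>inv f\<close> is an isomorphism from the inversion graph of
  \<open>inv f\<close> onto that of \<open>f\<close>. Facts about the left end of a block thereby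
  apply to \<open>inv f\<close> as well, which yields the inverse cycles.\<close>

lemma sparse_inv:
  assumes p: "f permutes S" and s: "sparse f"
  shows "sparse (inv f)"
proof -
  have inj: "inv f x = inv f y \<longleftrightarrow> x = y" for x y
    using permutes_inverses(1)[OF p] by metis
  have "False" if "x < y" "y < z" "inv f z < inv f y" "inv f y < inv f x" for x y z
    using s that permutes_inverses(1)[OF p] unfolding sparse_def by metis
  then show ?thesis
    using s unfolding sparse_def inverted_inv[OF p] by (metis inj)
qed

section \<open>The initial block of a sparse permutation\<close>

lemma permutes_interval_mem:
  fixes f :: "nat \<Rightarrow> nat"
  assumes "f permutes {b..n}" "f x \<noteq> x"
  shows "b \<le> x" "x \<le> n" "b \<le> f x" "f x \<le> n"
  using assms permutes_in_image[OF assms(1), of x] permutes_not_in[OF assms(1), of x] by auto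

text \<open>The right end of the block affects \<open>sigmaX\<close> at even offsets only, hence the
  one-sided bound. What remains is the pattern that \<open>path_extension\<close> prolongs.\<close>

lemma sigmaX_inner:
  assumes "b \<le> x" "x \<le> a" "even (x - b) \<Longrightarrow> x + 2 \<le> a"
  shows "sigmaX b a x = (if even (x - b) then x + 2 else if x = b + 1 then b else x - 2)"
proof (cases "even (x - b)")
  case False
  then have "x = b + 1 \<or> b + 3 \<le> x" using assms(1) by presburger
  then show ?thesis using assms False by (auto simp: sigmaX_def)
qed (use assms in \<open>auto simp: sigmaX_def\<close>)

text \<open>Positions up to \<open>t\<close> use up exactly the values at most \<open>t + 1\<close>
  other than \<open>t\<close>. The degree bound leaves the position \<open>c\<close> of the value
  \<open>t\<close> only the places \<open>t + 1\<close> and \<open>t + 2\<close>, and in the second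
  case leaves \<open>f (t + 1)\<close> only the values \<open>t + 2\<close> and
  \<open>t + 3\<close>. Two of the three outcomes close the block at \<open>c\<close>, with an odd
  or an even number of elements; the third prolongs the pattern by two positions.\<close>

lemma path_extension:
  fixes f :: "nat \<Rightarrow> nat"
  assumes p: "f permutes {b..n}" and s: "sparse f"
    and t: "t = b + 2 * i + 1"
    and pat: "\<forall>x. b \<le> x \<and> x \<le> t \<longrightarrow>
        f x = (if even (x - b) then x + 2 else if x = b + 1 then b else x - 2)"
    and low: "\<forall>x\<le>t. f x \<le> t + 1 \<and> f x \<noteq> t"
    and high: "\<forall>y>t. f y = t \<or> t + 2 \<le> f y"
  shows "\<exists>a\<in>{b..n}. \<forall>x\<in>{b..a}. f x = sigmaX b a x"
  using t pat low high
proof (induction "n - i" arbitrary: i t rule: less_induct)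
  case less
  note t = less.prems(1) and pat = less.prems(2) and low = less.prems(3) and high = less.prems(4)
  have ft: "f (t - 1) = t + 1" using pat[rule_format, of "t - 1"] t by simp
  have inj: "f x = f y \<longleftrightarrow> x = y" for x y using permutes_inj[OF p] by (simp add: inj_eq)
  have surj: "\<exists>x. f x = y" for y using permutes_surj[OF p] by (metis surjD)
  obtain c where c: "f c = t" using surj by blast
  have ct: "t < c" using low[rule_format, of c] c by (cases "c \<le> t") auto
  have cn: "c \<le> n" "b \<le> c" using permutes_interval_mem[OF p, of c] c ct by auto
  have ge: "t + 2 \<le> f y" if "t < y" "y \<noteq> c" for y
    using high that c inj[of y c] by metis
  \<comment> \<open>Beyond \<open>t + 2\<close>, the position \<open>c\<close> would have three
    neighbours: \<open>t - 1\<close>, whose value is \<open>t + 1\<close>, and the skipped positions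
    \<open>t + 1\<close> and \<open>t + 2\<close>, whose values are larger than
    \<open>t\<close>.\<close>
  have c2: "c \<le> t + 2"
  proof (rule ccontr)
    assume "\<not> ?thesis"
    then have "inverted f c (t - 1)" "inverted f c (t + 1)" "inverted f c (t + 2)"
      using c ft ge[of "t + 1"] ge[of "t + 2"] t unfolding inverted_def by auto
    from sparse_degree[OF s this] show False by auto
  qed
  show ?case
  proof (cases "c = t + 1")
    case True
    have "f x = sigmaX b c x" if "x \<in> {b..c}" for x
    proof (cases "x = c")
      case True
      then show ?thesis using \<open>c = t + 1\<close> c t by (simp add: sigmaX_def)
    next
      case False
      then have xt: "b \<le> x" "x \<le> t" using that \<open>c = t + 1\<close> by auto
      have "even (x - b) \<Longrightarrow> x \<noteq> t" using t by auto
      then show ?thesis using pat[rule_format, of x] xt \<open>c = t + 1\<close>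
        by (subst sigmaX_inner) auto
    qed
    then show ?thesis using cn by (intro bexI[of _ c]) auto
  next
    case False
    then have cc: "c = t + 2" using c2 ct by auto
    have g: "t + 2 \<le> f (t + 1)" using ge cc by simp
    \<comment> \<open>Otherwise \<open>t + 1\<close> is inverted with \<open>c\<close> and with the
      positions of the values \<open>t + 2\<close> and \<open>t + 3\<close>, all of which lie to its
      right.\<close>
    have "f (t + 1) \<le> t + 3"
    proof (rule ccontr)
      assume H: "\<not> ?thesis"
      obtain y where y: "f y = t + 2" using surj by blast
      obtain z where z: "f z = t + 3" using surj by blast
      have "t < y" "t < z" using low y z by (force simp flip: not_le)+
      moreover have "y \<noteq> t + 1" "y \<noteq> t + 2" "z \<noteq> t + 1" "z \<noteq> t + 2" using H y z c cc by auto
      ultimately have "inverted f (t + 1) (t + 2)" "inverted f (t + 1) y" "inverted f (t + 1) z"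
        using H y z c cc unfolding inverted_def by auto
      from sparse_degree[OF s this] show False using y z \<open>y \<noteq> t + 2\<close> \<open>z \<noteq> t + 2\<close> by auto
    qed
    then consider "f (t + 1) = t + 2" | "f (t + 1) = t + 3" using g by linarith
    then show ?thesis
    proof cases
      case 1
      have "f x = sigmaX b c x" if xc: "x \<in> {b..c}" for x
      proof -
        consider "x = t + 2" | "x = t + 1" | "x \<le> t" using xc cc by force
        then show ?thesis
        proof cases
          case 3
          have xt: "b \<le> x" using xc by auto
          show ?thesis using pat[rule_format, of x] xt 3 cc
            by (subst sigmaX_inner) auto
        qed (use 1 c cc t in \<open>auto simp: sigmaX_def\<close>)
      qed
      then show ?thesis using cn by (intro bexI[of _ c]) auto
    next
      case 2
      show ?thesis
      proof (rule less.hyps[of "Suc i" "t + 2"])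
        \<comment> \<open>Here \<open>c = t + 2\<close> and \<open>c \<le> n\<close> force
          \<open>i < n\<close>, so the truncated difference really drops.\<close>
        show "n - Suc i < n - i" using cn cc t by auto
        show "t + 2 = b + 2 * Suc i + 1" using t by simp
        show "\<forall>x. b \<le> x \<and> x \<le> t + 2 \<longrightarrow>
          f x = (if even (x - b) then x + 2 else if x = b + 1 then b else x - 2)"
        proof (intro allI impI)
          fix x assume x: "b \<le> x \<and> x \<le> t + 2"
          then consider "x \<le> t" | "x = t + 1" | "x = t + 2" by force
          then show "f x = (if even (x - b) then x + 2 else if x = b + 1 then b else x - 2)"
            using pat x 2 c cc t by cases auto
        qed
        show "\<forall>x\<le>t + 2. f x \<le> t + 2 + 1 \<and> f x \<noteq> t + 2"
        proof (intro allI impI)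
          fix x assume "x \<le> t + 2"
          then consider "x \<le> t" | "x = t + 1" | "x = t + 2" by force
          then show "f x \<le> t + 2 + 1 \<and> f x \<noteq> t + 2"
          proof cases
            case 1
            then have "f x \<le> t + 1" using low by blast
            then show ?thesis by simp
          qed (use 2 c cc in auto)
        qed
        show "\<forall>y>t + 2. f y = t + 2 \<or> t + 2 + 2 \<le> f y"
        proof (intro allI impI)
          fix y assume "t + 2 < y"
          then have "t + 2 \<le> f y" "f y \<noteq> t + 3" using ge[of y] cc inj[of y "t + 1"] 2 by auto
          then show "f y = t + 2 \<or> t + 2 + 2 \<le> f y" by auto
        qed
      qed
    qed
  qed
qed

text \<open>If \<open>f b\<close> were larger, the positions of the values \<open>b\<close>,
  \<open>b + 1\<close> and \<open>b + 2\<close> would all lie to the right of \<open>b\<close> and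
  be three neighbours of it.\<close>

lemma first_moved:
  fixes f :: "nat \<Rightarrow> nat"
  assumes p: "f permutes {b..n}" and s: "sparse f"
  shows "f b \<le> b + 2"
proof (rule ccontr)
  assume H: "\<not> ?thesis"
  have surj: "\<exists>x. f x = y" for y using permutes_surj[OF p] by (metis surjD)
  have below: "f x = x" if "x < b" for x using permutes_not_in[OF p] that by simp
  obtain x where x: "f x = b" using surj by blast
  obtain y where y: "f y = b + 1" using surj by blast
  obtain z where z: "f z = b + 2" using surj by blast
  have "b < x" "b < y" "b < z" using H x y z below[of x] below[of y] below[of z]
    by (cases x b rule: linorder_cases; cases y b rule: linorder_cases; cases z b rule: linorder_cases; force)+
  then have "inverted f b x" "inverted f b y" "inverted f b z"
    using H x y z unfolding inverted_def by auto
  from sparse_degree[OF s this] show False using x y z by auto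
qed

text \<open>The two given values are the pattern of \<open>path_extension\<close> for
  \<open>i = 0\<close> and \<open>t = b + 1\<close>.\<close>

lemma sigma_block:
  fixes f :: "nat \<Rightarrow> nat"
  assumes p: "f permutes {b..n}" and s: "sparse f" and f: "f b = b + 2" "f (b + 1) = b"
  shows "\<exists>a\<in>{b..n}. \<forall>x\<in>{b..a}. f x = sigmaX b a x"
proof -
  have below: "f x = x" if "x < b" for x using permutes_not_in[OF p] that by simp
  have inj: "f x = f y \<longleftrightarrow> x = y" for x y using permutes_inj[OF p] by (simp add: inj_eq)
  show ?thesis
  proof (rule path_extension[OF p s, of "b + 1" 0])
    show "\<forall>x. b \<le> x \<and> x \<le> b + 1 \<longrightarrow>
        f x = (if even (x - b) then x + 2 else if x = b + 1 then b else x - 2)"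
    proof (intro allI impI)
      fix x assume "b \<le> x \<and> x \<le> b + 1"
      then have "x = b \<or> x = b + 1" by auto
      then show "f x = (if even (x - b) then x + 2 else if x = b + 1 then b else x - 2)"
        using f by auto
    qed
    show "\<forall>x\<le>b + 1. f x \<le> b + 1 + 1 \<and> f x \<noteq> b + 1"
    proof (intro allI impI)
      fix x assume "x \<le> b + 1"
      then consider "x < b" | "x = b" | "x = b + 1" by force
      then show "f x \<le> b + 1 + 1 \<and> f x \<noteq> b + 1" using f below by cases auto
    qed
    show "\<forall>y>b + 1. f y = b + 1 \<or> b + 1 + 2 \<le> f y"
    proof (intro allI impI)
      fix y assume y: "b + 1 < y"
      have "b \<le> f y" using below inj[of "f y" y] y by (metis not_le add_lessD1 less_trans less_irrefl)
      moreover have "f y \<noteq> b" "f y \<noteq> b + 2" using inj[of y b] inj[of y "b + 1"] f y by auto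
      ultimately show "f y = b + 1 \<or> b + 1 + 2 \<le> f y" by auto
    qed
  qed simp
qed

text \<open>The value \<open>b + 1\<close> at position \<open>b + 1\<close> would complete a
  decreasing triple. After that the degree bound forces the position of the value
  \<open>b + 1\<close>, and then the value at \<open>b + 1\<close>. The inversion graph closes up to
  a 4-cycle.\<close>

lemma tau_block:
  fixes f :: "nat \<Rightarrow> nat"
  assumes p: "f permutes {b..n}" and s: "sparse f" and f: "f b = b + 2" "f (b + 2) = b"
  shows "b + 3 \<le> n \<and> f (b + 1) = b + 3 \<and> f (b + 3) = b + 1"
proof -
  have below: "f x = x" if "x < b" for x using permutes_not_in[OF p] that by simp
  have inj: "f x = f y \<longleftrightarrow> x = y" for x y using permutes_inj[OF p] by (simp add: inj_eq)
  have surj: "\<exists>x. f x = y" for y using permutes_surj[OF p] by (metis surjD)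
  have up: "b + 1 \<le> f y" if "b < y" "y \<noteq> b + 2" for y
  proof -
    have "b \<le> f y" using below inj[of "f y" y] that by (metis not_le less_trans less_irrefl)
    then show ?thesis using inj[of y "b + 2"] f that by auto
  qed
  have n1: "f (b + 1) \<noteq> b + 1"
  proof
    assume "f (b + 1) = b + 1"
    then have "f (b + 2) < f (b + 1) \<and> f (b + 1) < f b" using f by simp
    moreover have "b < b + 1" "b + 1 < b + 2" by simp_all
    ultimately show False using s unfolding sparse_def by metis
  qed
  have n2: "f (b + 1) \<noteq> b + 2" using inj[of "b + 1" b] f by auto
  have ge: "b + 3 \<le> f (b + 1)" using up[of "b + 1"] n1 n2 by simp
  obtain y where y: "f y = b + 1" using surj by blast
  have "y \<noteq> b" "y \<noteq> b + 1" "y \<noteq> b + 2" "\<not> y < b" using y f n1 below[of y] by auto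
  then have yb: "b + 2 < y" by auto
  \<comment> \<open>Further right, \<open>y\<close> would be inverted with \<open>b\<close>,
    \<open>b + 1\<close> and \<open>b + 3\<close>.\<close>
  have y3: "y = b + 3"
  proof (rule ccontr)
    assume "\<not> ?thesis"
    then have "b + 3 < y" using yb by auto
    moreover have "b + 1 < f (b + 3)" using up[of "b + 3"] inj[of "b + 3" y] y calculation by auto
    ultimately have "inverted f y b" "inverted f y (b + 1)" "inverted f y (b + 3)"
      using y f ge unfolding inverted_def by auto
    from sparse_degree[OF s this] show False by auto
  qed
  have "f (b + 1) = b + 3"
  proof (rule ccontr)
    assume H: "\<not> ?thesis"
    obtain z where z: "f z = b + 3" using surj by blast
    have "z \<noteq> b" "z \<noteq> b + 1" "z \<noteq> b + 2" "\<not> z < b" "z \<noteq> y" using z f H y below[of z] by auto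
    then have "inverted f (b + 1) (b + 2)" "inverted f (b + 1) y" "inverted f (b + 1) z"
      using H ge z y f yb unfolding inverted_def by auto
    from sparse_degree[OF s this] show False using y3 \<open>z \<noteq> b + 2\<close> \<open>z \<noteq> y\<close> by auto
  qed
  then show ?thesis using y y3 permutes_interval_mem[OF p, of y] by auto
qed

section \<open>The involutions \<open>pi1_pos\<close> and \<open>pi2_pos\<close> and the cycle
  \<open>sigmaX\<close>\<close>

lemma pi1_pos_mem: "j \<in> {1..m} \<Longrightarrow> pi1_pos m j \<in> {1..m}"
  and pi2_pos_mem: "j \<in> {1..m} \<Longrightarrow> pi2_pos m j \<in> {1..m}"
  unfolding pi1_pos_def pi2_pos_def by (auto elim!: evenE oddE)

lemma pi1_pos_invol: "j \<in> {1..m} \<Longrightarrow> pi1_pos m (pi1_pos m j) = j"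
  and pi2_pos_invol: "j \<in> {1..m} \<Longrightarrow> pi2_pos m (pi2_pos m j) = j"
  unfolding pi1_pos_def pi2_pos_def by (auto elim!: evenE oddE)

text \<open>Points move by at most one, and two points at distance 2 have the same parity, so they
  never move towards each other.\<close>

lemma pi1_pos_mono: "1 \<le> i \<Longrightarrow> i + 2 \<le> j \<Longrightarrow> j \<le> m \<Longrightarrow> pi1_pos m i < pi1_pos m j"
  and pi2_pos_mono: "1 \<le> i \<Longrightarrow> i + 2 \<le> j \<Longrightarrow> j \<le> m \<Longrightarrow> pi2_pos m i < pi2_pos m j"
  unfolding pi1_pos_def pi2_pos_def by presburger+

text \<open>Swapped pairs start at odd positions for \<open>pi1_pos\<close> and at even ones for
  \<open>pi2_pos\<close>, so each consecutive pair is reversed by exactly one of them.\<close>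

lemma pi1_pos_Suc: "1 \<le> i \<Longrightarrow> i < m \<Longrightarrow> pi1_pos m i < pi1_pos m (Suc i) \<longleftrightarrow> even i"
  and pi2_pos_Suc: "1 \<le> i \<Longrightarrow> i < m \<Longrightarrow> pi2_pos m i < pi2_pos m (Suc i) \<longleftrightarrow> odd i"
  unfolding pi1_pos_def pi2_pos_def by (auto elim!: evenE oddE)

text \<open>In coordinates counted from 1 inside the block, the cycle is a product of two
  involutions, as a rotation is a product of two reflections.\<close>

lemma sigmaX_pos:
  assumes "j \<in> {1..a + 1 - b}"
  shows "sigmaX b a (b + j - 1) = b + pi2_pos (a + 1 - b) (pi1_pos (a + 1 - b) j) - 1"
  using assms unfolding sigmaX_def pi1_pos_def pi2_pos_def
  by (cases j) (auto elim!: evenE oddE)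

lemma pos_offset: "(x :: nat) \<in> {b..a} \<Longrightarrow> x + 1 - b \<in> {1..a + 1 - b} \<and> b + (x + 1 - b) - 1 = x"
  by auto

text \<open>Here \<open>j\<close> numbers the vertices along the inversion path:
  \<open>pi1_pos\<close> gives the place in the new ordering and \<open>pi2_pos\<close> the place in
  the old one.\<close>

lemma sigmaX_pos_inv:
  assumes "j \<in> {1..a + 1 - b}"
  shows "sigmaX b a (b + pi1_pos (a + 1 - b) j - 1) = b + pi2_pos (a + 1 - b) j - 1"
  using sigmaX_pos[OF pi1_pos_mem[OF assms]] pi1_pos_invol[OF assms] by simp

lemma sigmaX_permutes: "sigmaX b a permutes {b..a}"
proof (rule bij_imp_permutes)
  let ?m = "a + 1 - b"
  \<comment> \<open>The inverse of a product of two involutions is their product in the other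
    order.\<close>
  let ?g = "\<lambda>x. b + pi1_pos ?m (pi2_pos ?m (x + 1 - b)) - 1"
  have *: "sigmaX b a x \<in> {b..a} \<and> ?g x \<in> {b..a} \<and> ?g (sigmaX b a x) = x \<and> sigmaX b a (?g x) = x"
    if x: "x \<in> {b..a}" for x
  proof -
    obtain j where j: "j \<in> {1..?m}" and xj: "x = b + j - 1" and jx: "x + 1 - b = j"
      using pos_offset[OF x] by metis
    have s: "sigmaX b a x = b + pi2_pos ?m (pi1_pos ?m j) - 1" using sigmaX_pos[OF j] xj by simp
    have m1: "pi1_pos ?m j \<in> {1..?m}" and m2: "pi2_pos ?m j \<in> {1..?m}"
      using pi1_pos_mem[OF j] pi2_pos_mem[OF j] .
    have m21: "pi2_pos ?m (pi1_pos ?m j) \<in> {1..?m}" and m12: "pi1_pos ?m (pi2_pos ?m j) \<in> {1..?m}"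
      using pi2_pos_mem[OF m1] pi1_pos_mem[OF m2] .
    have mem: "sigmaX b a x \<in> {b..a}" unfolding s using m21 by auto
    have g: "?g (sigmaX b a x) = x"
    proof -
      have "sigmaX b a x + 1 - b = pi2_pos ?m (pi1_pos ?m j)" using s m21 by auto
      then show ?thesis using pi2_pos_invol[OF m1] pi1_pos_invol[OF j] xj by simp
    qed
    moreover have "sigmaX b a (?g x) = x"
      unfolding jx using sigmaX_pos_inv[OF m2] pi2_pos_invol[OF j] xj by simp
    moreover have "?g x \<in> {b..a}" unfolding jx using m12 by auto
    ultimately show ?thesis using mem by blast
  qed
  show "bij_betw (sigmaX b a) {b..a} {b..a}"
    by (rule bij_betw_byWitness[where f' = ?g]) (use * in blast)+
qed (auto simp: sigmaX_def)

lemma tauX_permutes: "tauX b permutes {b..b + 3}"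
proof (rule bij_imp_permutes)
  show "bij_betw (tauX b) {b..b + 3} {b..b + 3}"
    by (rule bij_betw_byWitness[where f' = "tauX b"]) (auto simp: tauX_def)
qed (auto simp: tauX_def)

section \<open>Decomposition of a sparse permutation into blocks\<close>

lemma block_perm_permutes:
  assumes "k = Tau \<Longrightarrow> a + 1 - b = 4"
  shows "block_perm k b a permutes {b..a}"
proof (cases k)
  case Tau
  then have "a = b + 3" using assms by auto
  then show ?thesis using Tau tauX_permutes by (simp add: block_perm_def)
qed (auto simp: block_perm_def sigmaX_permutes permutes_inv)

text \<open>By \<open>first_moved\<close> for \<open>f\<close> and \<open>inv f\<close>, five
  possibilities remain for the pair \<open>f b\<close>, \<open>inv f b\<close>: a fixed point, a
  transposition, an inverse cycle, a cycle, and \<open>tauX\<close>. On one or two points the cycle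
  is its own inverse, and \<open>Sig\<close> is chosen.\<close>

lemma first_block:
  assumes p: "f permutes {b..n}" and s: "sparse f" and "b \<le> n"
  shows "\<exists>a\<in>{b..n}. \<exists>k. (k = Tau \<longrightarrow> a + 1 - b = 4) \<and> (\<forall>x\<in>{b..a}. f x = block_perm k b a x)"
proof -
  note pi = permutes_inv[OF p] and si = sparse_inv[OF p s]
  have ii: "f (inv f x) = x" "inv f (f x) = x" for x using permutes_inverses[OF p] by auto
  have fb: "f b \<in> {b..n}" and gb: "inv f b \<in> {b..n}"
    using permutes_in_image[OF p, of b] permutes_in_image[OF pi, of b] \<open>b \<le> n\<close> by auto
  consider "f b = b" | "f b = b + 1" "inv f b = b + 1" | "f b = b + 1" "inv f b = b + 2"
    | "f b = b + 2" "inv f b = b + 1" | "f b = b + 2" "inv f b = b + 2"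
    using first_moved[OF p s] first_moved[OF pi si] fb gb ii[of b]
  proof -
    have "f b = b \<or> f b = b + 1 \<or> f b = b + 2" "inv f b = b \<or> inv f b = b + 1 \<or> inv f b = b + 2"
      using first_moved[OF p s] first_moved[OF pi si] fb gb by auto
    moreover have "inv f b = b \<Longrightarrow> f b = b" using ii(1)[of b] by simp
    ultimately show ?thesis using that by blast
  qed
  then show ?thesis
  proof cases
    case 1
    then show ?thesis using \<open>b \<le> n\<close>
      by (intro bexI[of _ b] exI[of _ Sig]) (auto simp: block_perm_def sigmaX_def)
  next
    case 2
    then have "f (b + 1) = b" "b + 1 \<le> n" using ii(1)[of b] gb by auto
    moreover have "f x = sigmaX b (b + 1) x" if "x \<in> {b..b + 1}" for x
    proof -
      have "x = b \<or> x = b + 1" using that by auto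
      then show ?thesis using 2(1) \<open>f (b + 1) = b\<close> by (auto simp: sigmaX_def)
    qed
    ultimately show ?thesis
      by (intro bexI[of _ "b + 1"] exI[of _ Sig]) (simp_all add: block_perm_def)
  next
    case 3
    \<comment> \<open>In this case \<open>inv f\<close> starts like a cycle, so the block is found
      for \<open>inv f\<close> and carried back to \<open>f\<close>.\<close>
    have "inv f (b + 1) = b" using ii(2)[of b] 3 by simp
    from sigma_block[OF pi si _ this] 3 obtain a
      where a: "a \<in> {b..n}" "\<forall>x\<in>{b..a}. inv f x = sigmaX b a x" by auto
    have "f x = inv (sigmaX b a) x" if "x \<in> {b..a}" for x
    proof -
      let ?y = "inv (sigmaX b a) x"
      have "?y \<in> {b..a}" using permutes_in_image[OF permutes_inv[OF sigmaX_permutes]] that by auto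
      then have "inv f ?y = x" using a permutes_inverses(1)[OF sigmaX_permutes] by simp
      then show ?thesis using ii(1) by metis
    qed
    then show ?thesis using a(1) by (intro bexI[of _ a] exI[of _ SigInv]) (simp_all add: block_perm_def)
  next
    case 4
    then have "f (b + 1) = b" using ii(1)[of b] by simp
    from sigma_block[OF p s 4(1) this] obtain a
      where "a \<in> {b..n}" "\<forall>x\<in>{b..a}. f x = sigmaX b a x" by blast
    then show ?thesis by (intro bexI[of _ a] exI[of _ Sig]) (simp_all add: block_perm_def)
  next
    case 5
    then have f2: "f (b + 2) = b" using ii(1)[of b] by simp
    note t = tau_block[OF p s 5(1) f2]
    have "f x = tauX b x" if "x \<in> {b..b + 3}" for x
    proof -
      have "x = b \<or> x = b + 1 \<or> x = b + 2 \<or> x = b + 3" using that by auto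
      then show ?thesis using t f2 5(1) by (auto simp: tauX_def)
    qed
    then show ?thesis using t
      by (intro bexI[of _ "b + 3"] exI[of _ Tau]) (simp_all add: block_perm_def)
  qed
qed

text \<open>The left end \<open>c\<close> is a parameter so that blocks can be split off by
  induction. The last clause makes the product local: \<open>f\<close> acts on each block as its
  factor, and no inversion crosses the border of a block.\<close>

definition interval_decomposition ::
  "(nat \<Rightarrow> nat) \<Rightarrow> nat \<Rightarrow> nat \<Rightarrow> nat \<Rightarrow> (nat \<Rightarrow> nat) \<Rightarrow> (nat \<Rightarrow> nat) \<Rightarrow> (nat \<Rightarrow> kind) \<Rightarrow> bool" where
  "interval_decomposition f c n r b a k \<longleftrightarrow>
     r \<ge> 1 \<and> b 1 = c \<and> a r = n \<and>
     (\<forall>i\<in>{1..r}. c \<le> b i \<and> b i \<le> a i \<and> a i \<le> n) \<and>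
     (\<forall>i\<in>{1..<r}. b (Suc i) = a i + 1) \<and>
     (\<forall>i\<in>{1..r}. k i = Tau \<longrightarrow> a i + 1 - b i = 4) \<and>
     f = foldr (\<lambda>i f. block_perm (k i) (b i) (a i) \<circ> f) [1..<Suc r] id \<and>
     (\<forall>i\<in>{1..r}. (\<forall>x\<in>{b i..a i}. f x = block_perm (k i) (b i) (a i) x) \<and>
        (\<forall>x<b i. f x < b i) \<and> (\<forall>x>a i. a i < f x))"

lemma interval_decompositionD:
  assumes "interval_decomposition f c n r b a k"
  shows "r \<ge> 1" "b 1 = c" "a r = n"
    "\<forall>i\<in>{1..r}. c \<le> b i \<and> b i \<le> a i \<and> a i \<le> n"
    "\<forall>i\<in>{1..<r}. b (Suc i) = a i + 1"
    "\<forall>i\<in>{1..r}. k i = Tau \<longrightarrow> a i + 1 - b i = 4"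
    "f = foldr (\<lambda>i f. block_perm (k i) (b i) (a i) \<circ> f) [1..<Suc r] id"
    "\<forall>i\<in>{1..r}. (\<forall>x\<in>{b i..a i}. f x = block_perm (k i) (b i) (a i) x) \<and>
        (\<forall>x<b i. f x < b i) \<and> (\<forall>x>a i. a i < f x)"
  using assms unfolding interval_decomposition_def by blast+

text \<open>Induction on the length of the interval: the first block is divided out, and the
  remaining permutation lives on the positions to its right and is again sparse.\<close>

lemma interval_decomposition_exists:
  assumes "f permutes {c..n}" "sparse f" "c \<le> n"
  shows "\<exists>r b a k. interval_decomposition f c n r b a k"
  using assms
proof (induction "n - c" arbitrary: c f rule: less_induct)
  case less
  note p = less.prems(1) and s = less.prems(2) and cn = less.prems(3)
  obtain a0 k0 where "a0 \<in> {c..n}" and k0: "k0 = Tau \<longrightarrow> a0 + 1 - c = 4"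
    and "\<forall>x\<in>{c..a0}. f x = block_perm k0 c a0 x"
    using first_block[OF p s cn] by blast
  then have a0: "c \<le> a0" "a0 \<le> n"
    and eq: "\<And>x. x \<in> {c..a0} \<Longrightarrow> f x = block_perm k0 c a0 x" by auto
  let ?g = "block_perm k0 c a0"
  have g: "?g permutes {c..a0}" using block_perm_permutes k0 by blast
  have below: "f x = x" if "x < c" for x using permutes_not_in[OF p] that by simp
  have inj: "f x = f y \<longleftrightarrow> x = y" for x y using permutes_inj[OF p] by (simp add: inj_eq)
  \<comment> \<open>The positions in \<open>{c..a0}\<close> already take every value of that
    interval, and positions below \<open>c\<close> are fixed.\<close>
  have above: "a0 < f x" if "a0 < x" for x
  proof (rule ccontr)
    assume H: "\<not> ?thesis"
    show False
    proof (cases "f x < c")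
      case True
      then show False using below[of "f x"] inj[of "f x" x] that a0 by simp
    next
      case False
      then have "f x \<in> {c..a0}" using H by simp
      moreover obtain y where y: "?g y = f x" using permutes_surj[OF g] by (metis surjD)
      ultimately have "y \<in> {c..a0}" using permutes_in_image[OF g, of y] by simp
      then have "f y = f x" using eq y by simp
      then show False using inj \<open>y \<in> {c..a0}\<close> that by simp
    qed
  qed
  define h where "h = inv ?g \<circ> f"
  have f_eq: "f = ?g \<circ> h" unfolding h_def using permutes_inverses(1)[OF g] by (auto simp: fun_eq_iff)
  have h: "h x = (if a0 < x then f x else x)" for x
  proof -
    consider "x < c" | "x \<in> {c..a0}" | "a0 < x" by force
    then show ?thesis
    proof cases
      case 1
      then show ?thesis using below[OF 1] a0 permutes_not_in[OF permutes_inv[OF g], of x] by (simp add: h_def)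
    next
      case 2
      then show ?thesis using eq[OF 2] permutes_inverses(2)[OF g] by (simp add: h_def)
    next
      case 3
      then show ?thesis using above[OF 3] permutes_not_in[OF permutes_inv[OF g], of "f x"] by (simp add: h_def)
    qed
  qed
  show ?case
  proof (cases "a0 = n")
    case True
    have "f x = ?g x" for x using eq permutes_not_in[OF p] permutes_not_in[OF g] True by metis
    then have "f = ?g" by auto
    then have "interval_decomposition f c n 1 (\<lambda>_. c) (\<lambda>_. a0) (\<lambda>_. k0)"
      unfolding interval_decomposition_def using True a0 k0 above below by auto
    then show ?thesis by blast
  next
    case False
    then have an: "a0 + 1 \<le> n" using a0 by simp
    have hp: "h permutes {a0 + 1..n}"
    proof (rule permutes_superset)
      show "h permutes {c..n}" unfolding h_def
        using permutes_compose[OF p permutes_subset[OF permutes_inv[OF g]]] a0 by auto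
    qed (auto simp: h)
    \<comment> \<open>Both points of an inversion of \<open>h\<close> lie beyond \<open>a0\<close>,
      where \<open>h\<close> agrees with \<open>f\<close>.\<close>
    have "inverted f x y" if "inverted h x y" for x y
      using that above[of x] above[of y] unfolding inverted_def by (auto simp: h split: if_splits)
    moreover have "False" if "x < y" "y < z" "h z < h y" "h y < h x" for x y z
    proof -
      have "inverted h x y" "inverted h y z" using that unfolding inverted_def by auto
      then have "inverted f x y" "inverted f y z" using calculation by auto
      then have "f z < f y" "f y < f x" using that unfolding inverted_def by auto
      then show False using s that unfolding sparse_def by metis
    qed
    ultimately have hs: "sparse h" using s unfolding sparse_def by metis
    have lt: "n - (a0 + 1) < n - c" using an a0 by simp
    from less.hyps[OF lt hp hs an] obtain r b a k
      where D: "interval_decomposition h (a0 + 1) n r b a k" by blast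
    note IH = interval_decompositionD(1-3)[OF D] interval_decompositionD(4-6)[OF D, THEN bspec]
      interval_decompositionD(7)[OF D] interval_decompositionD(8)[OF D, THEN bspec]
    let ?b = "\<lambda>i. if i = 1 then c else b (i - 1)"
    let ?a = "\<lambda>i. if i = 1 then a0 else a (i - 1)"
    let ?k = "\<lambda>i. if i = 1 then k0 else k (i - 1)"
    have split: "i = 1 \<or> i - 1 \<in> {1..r} \<and> i \<noteq> 1" if "i \<in> {1..Suc r}" for i using that by auto
    \<comment> \<open>On the first block \<open>h\<close> is the identity and \<open>f\<close> need
      not be, but the values of \<open>f\<close> there stay at most \<open>a0\<close>, to the left
      of every later block.\<close>
    have f_low: "f x < y" if "x < y" "h x < y" "a0 < y" for x y
      using that eq[of x] below[of x] permutes_in_image[OF g, of x]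
      by (cases "x < c"; cases "x \<le> a0") (auto simp: h)
    have "f = foldr (\<lambda>i f. block_perm (?k i) (?b i) (?a i) \<circ> f) [1..<Suc (Suc r)] id"
    proof -
      have "[1..<Suc (Suc r)] = 1 # map Suc [1..<Suc r]"
        by (simp add: map_Suc_upt upt_conv_Cons del: upt_Suc)
      moreover have "foldr (\<lambda>i f. block_perm (?k i) (?b i) (?a i) \<circ> f) (map Suc [1..<Suc r]) id = h"
        unfolding IH(7) foldr_map by (rule foldr_cong) (auto simp: fun_eq_iff)
      ultimately show ?thesis using f_eq by simp
    qed
    moreover have "\<forall>i\<in>{1..Suc r}. (\<forall>x\<in>{?b i..?a i}. f x = block_perm (?k i) (?b i) (?a i) x) \<and>
        (\<forall>x<?b i. f x < ?b i) \<and> (\<forall>x>?a i. ?a i < f x)"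
    proof
      fix i assume i: "i \<in> {1..Suc r}"
      show "(\<forall>x\<in>{?b i..?a i}. f x = block_perm (?k i) (?b i) (?a i) x) \<and>
        (\<forall>x<?b i. f x < ?b i) \<and> (\<forall>x>?a i. ?a i < f x)"
      proof (cases "i = 1")
        case True
        then show ?thesis using eq below above by auto
      next
        case False
        then have j: "i - 1 \<in> {1..r}" using split[OF i] by blast
        have "h x = f x" if "b (i - 1) \<le> x \<or> a (i - 1) < x" for x
          using that IH(4)[OF j] by (auto simp: h)
        then show ?thesis using False IH(8)[OF j] IH(4)[OF j] f_low[of _ "b (i - 1)"] by auto
      qed
    qed
    moreover have "\<forall>i\<in>{1..Suc r}. c \<le> ?b i \<and> ?b i \<le> ?a i \<and> ?a i \<le> n"
      using IH(4) a0 by (force dest!: split)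
    moreover have "\<forall>i\<in>{1..<Suc r}. ?b (Suc i) = ?a i + 1"
    proof
      fix i assume i: "i \<in> {1..<Suc r}"
      show "?b (Suc i) = ?a i + 1"
      proof (cases "i = 1")
        case False
        then have "i - 1 \<in> {1..<r}" using i by auto
        from IH(5)[OF this] False show ?thesis using i by simp
      qed (use IH(2) in simp)
    qed
    moreover have "\<forall>i\<in>{1..Suc r}. ?k i = Tau \<longrightarrow> ?a i + 1 - ?b i = 4"
      using k0 IH(6) by (force dest!: split)
    moreover have "?a (Suc r) = n" using IH(1,3) by simp
    ultimately have "interval_decomposition f c n (Suc r) ?b ?a ?k"
      unfolding interval_decomposition_def by (intro conjI) simp_all
    then show ?thesis by blast
  qed
qed

section \<open>Backedges as an undirected graph on positions\<close>

definition backlinked :: "('a \<Rightarrow> 'a \<Rightarrow> bool) \<Rightarrow> nat \<Rightarrow> (nat \<Rightarrow> 'a) \<Rightarrow> nat \<Rightarrow> nat \<Rightarrow> bool" where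
  "backlinked E n w x y \<longleftrightarrow> x \<in> {1..n} \<and> y \<in> {1..n} \<and> (x < y \<and> E (w y) (w x) \<or> y < x \<and> E (w x) (w y))"

lemma backlinked_sym: "backlinked E n w x y \<Longrightarrow> backlinked E n w y x"
  unfolding backlinked_def by auto

text \<open>The cardinality bound at \<open>x\<close> turned into uniqueness of the partner; a link
  corresponds to the pair in \<open>backedges\<close> with the smaller position first.\<close>

lemma backlinked_unique:
  assumes "matching_ordering V E n w" and xy: "backlinked E n w x y" and xz: "backlinked E n w x z"
  shows "y = z"
proof -
  let ?S = "{(i, j) \<in> backedges E n w. i = x \<or> j = x}"
  have "x \<in> {1..n}" using xy by (simp add: backlinked_def)
  then have c: "card ?S \<le> Suc 0" using assms(1) by (simp add: matching_ordering_def)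
  have "finite ?S" by (rule finite_subset[of _ "{1..n} \<times> {1..n}"]) (auto simp: backedges_def)
  then have "p = q" if "p \<in> ?S" "q \<in> ?S" for p q
    using c that by (simp only: card_le_Suc0_iff_eq[OF \<open>finite ?S\<close>] Ball_def)
  moreover have "(min x t, max x t) \<in> ?S" if "backlinked E n w x t" for t
    using that by (auto simp: backlinked_def backedges_def min_def max_def)
  ultimately have "(min x y, max x y) = (min x z, max x z)" using xy xz by presburger
  then show ?thesis by (auto simp: min_def max_def split: if_splits)
qed

text \<open>The flag holds iff the swapped pairs start at even positions.\<close>
definition zigzag :: "bool \<Rightarrow> nat \<Rightarrow> (nat \<Rightarrow> nat) \<Rightarrow> bool" where
  "zigzag d m p \<longleftrightarrow> (\<forall>j\<in>{1..m}. p j \<in> {1..m} \<and> p (p j) = j) \<and>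
     (\<forall>i j. 1 \<le> i \<and> i + 2 \<le> j \<and> j \<le> m \<longrightarrow> p i < p j) \<and>
     (\<forall>i. 1 \<le> i \<and> i < m \<longrightarrow> (p i < p (Suc i) \<longleftrightarrow> odd i = d))"

lemma zigzag_pi1: "zigzag False m (pi1_pos m)"
  unfolding zigzag_def
proof (intro conjI ballI allI impI)
  fix i assume "1 \<le> i \<and> i < m"
  then show "pi1_pos m i < pi1_pos m (Suc i) \<longleftrightarrow> odd i = False" using pi1_pos_Suc[of i m] by simp
qed (use pi1_pos_mem pi1_pos_invol pi1_pos_mono in auto)

lemma zigzag_pi2: "zigzag True m (pi2_pos m)"
  unfolding zigzag_def
proof (intro conjI ballI allI impI)
  fix i assume "1 \<le> i \<and> i < m"
  then show "pi2_pos m i < pi2_pos m (Suc i) \<longleftrightarrow> odd i = True" using pi2_pos_Suc[of i m] by simp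
qed (use pi2_pos_mem pi2_pos_invol pi2_pos_mono in auto)

lemma zigzag_bij:
  assumes "zigzag d m p"
  shows "bij_betw p {1..m} {1..m}"
  by (rule bij_betw_byWitness[where f' = p]) (use assms in \<open>auto simp: zigzag_def\<close>)

section \<open>Inversions and the backedges of two matching orderings\<close>

locale two_matching_orderings =
  fixes V :: "'a set" and E :: "'a \<Rightarrow> 'a \<Rightarrow> bool" and n :: nat
    and v :: "nat \<Rightarrow> 'a" and \<pi> :: "nat \<Rightarrow> nat"
  assumes tour: "tournament V E"
    and v: "matching_ordering V E n v"
    and perm: "\<pi> permutes {1..n}"
    and v\<pi>: "matching_ordering V E n (v \<circ> \<pi>)"
begin

text \<open>The two graphs are indexed differently: the pair of vertices at places \<open>x\<close>
  and \<open>y\<close> of the new ordering has places \<open>\<pi> x\<close> and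
  \<open>\<pi> y\<close> in the old one. Hence \<open>new x y\<close> is compared with
  \<open>old (\<pi> x) (\<pi> y)\<close>.\<close>

abbreviation "old \<equiv> backlinked E n v"
abbreviation "new \<equiv> backlinked E n (v \<circ> \<pi>)"

lemmas old_unique = backlinked_unique[OF v]
lemmas new_unique = backlinked_unique[OF v\<pi>]

lemma v_bij: "bij_betw v {1..n} V"
  using v by (simp add: matching_ordering_def)

lemma \<pi>_eq_iff: "\<pi> x = \<pi> y \<longleftrightarrow> x = y"
  using permutes_inj[OF perm] by (simp add: inj_eq)

lemma \<pi>_mem: "\<pi> x \<in> {1..n} \<longleftrightarrow> x \<in> {1..n}"
  by (rule permutes_in_image[OF perm])

lemma edge_flip:
  assumes "x \<in> {1..n}" "y \<in> {1..n}" "x \<noteq> y"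
  shows "E (v x) (v y) \<longleftrightarrow> \<not> E (v y) (v x)"
proof -
  have "v x \<in> V" "v y \<in> V" using bij_betwE[OF v_bij] assms by blast+
  moreover have "v x \<noteq> v y"
    using inj_on_eq_iff[OF bij_betw_imp_inj_on[OF v_bij] assms(1,2)] assms(3) by simp
  ultimately show ?thesis using tour unfolding tournament_def by blast
qed

lemma edge_iff_old:
  assumes "x \<in> {1..n}" "y \<in> {1..n}" "x \<noteq> y"
  shows "E (v x) (v y) \<longleftrightarrow> (x < y) \<noteq> old x y"
  using assms edge_flip[OF assms] unfolding backlinked_def by auto

lemma inverted_mem:
  assumes "inverted \<pi> x y"
  shows "x \<in> {1..n}" "y \<in> {1..n}" "x \<noteq> y"
  using assms \<pi>_mem[of x] \<pi>_mem[of y] permutes_not_in[OF perm, of x] permutes_not_in[OF perm, of y]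
  unfolding inverted_def by (auto simp: not_le not_less_eq_eq)

lemma inverted_iff:
  assumes "x \<in> {1..n}" "y \<in> {1..n}" "x \<noteq> y"
  shows "inverted \<pi> x y \<longleftrightarrow> old (\<pi> x) (\<pi> y) \<noteq> new x y"
proof -
  have "\<pi> x \<in> {1..n}" "\<pi> y \<in> {1..n}" "\<pi> x \<noteq> \<pi> y" using assms \<pi>_mem \<pi>_eq_iff by auto
  from edge_flip[OF this] this show ?thesis using assms
    unfolding inverted_def backlinked_def by auto
qed

lemma inverted_cases:
  assumes "inverted \<pi> x y"
  obtains "old (\<pi> x) (\<pi> y)" | "new x y"
  using inverted_iff[OF inverted_mem[OF assms]] assms by blast

text \<open>Each inversion is a backedge of one of two matchings. Among three inversions at a point,
  or three forming a triangle, two belong to the same matching and share a vertex.\<close>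

lemma sparse_\<pi>: "sparse \<pi>"
  unfolding sparse_def
proof (intro conjI allI impI)
  fix x y z t assume "inverted \<pi> x y \<and> inverted \<pi> x z \<and> inverted \<pi> x t"
  then have "old (\<pi> x) (\<pi> y) \<or> new x y" "old (\<pi> x) (\<pi> z) \<or> new x z" "old (\<pi> x) (\<pi> t) \<or> new x t"
    using inverted_cases by blast+
  then show "y = z \<or> y = t \<or> z = t" using old_unique new_unique \<pi>_eq_iff by metis
next
  fix x y z :: nat assume o: "x < y \<and> y < z"
  show "\<not> (\<pi> z < \<pi> y \<and> \<pi> y < \<pi> x)"
  proof
    assume "\<pi> z < \<pi> y \<and> \<pi> y < \<pi> x"
    then have "inverted \<pi> x y" "inverted \<pi> y z" "inverted \<pi> x z" using o unfolding inverted_def by auto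
    then have *: "old (\<pi> x) (\<pi> y) \<or> new x y" "old (\<pi> y) (\<pi> z) \<or> new y z" "old (\<pi> x) (\<pi> z) \<or> new x z"
      using inverted_cases by blast+
    have "x \<noteq> y" "y \<noteq> z" "x \<noteq> z" using o by auto
    then show False using * old_unique new_unique \<pi>_eq_iff backlinked_sym by metis
  qed
qed

text \<open>A common backedge at x would be a second one beside the backedge that accounts for an
  inversion at x.\<close>
lemma no_common_backedge:
  assumes "x \<in> {1..n}" "s \<in> {1..n}" "x \<noteq> s" "\<not> inverted \<pi> x s" "inverted \<pi> x p"
  shows "\<not> old (\<pi> x) (\<pi> s)"
proof
  assume o: "old (\<pi> x) (\<pi> s)"
  then have "new x s" using inverted_iff[OF assms(1-3)] assms(4) by blast
  with o assms(4,5) show False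
    using old_unique new_unique \<pi>_eq_iff by (metis inverted_cases)
qed

section \<open>Homogeneity and internal structure of a block\<close>

lemma homogeneous_block:
  assumes "1 \<le> b" "a \<le> n"
    and low: "\<forall>x<b. \<pi> x < b" and high: "\<forall>x>a. a < \<pi> x"
    and blk: "\<forall>x\<in>{b..a}. \<pi> x \<in> {b..a}"
    and inv: "\<forall>x\<in>{b..a}. \<exists>p. inverted \<pi> x p"
  shows "homogeneous V E (v ` {b..a})"
  unfolding homogeneous_def
proof (intro conjI ballI)
  show "v ` {b..a} \<subseteq> V" using v_bij assms(1,2) by (auto simp: bij_betw_def)
  have pre: "\<exists>y. \<pi> y = x \<and> y \<in> {1..n}" if "x \<in> {1..n}" for x
    using that permutes_surj[OF perm] \<pi>_mem by (metis surjD)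
  \<comment> \<open>The pair is pulled back to its places \<open>y\<close> and \<open>s\<close> in
    the new ordering. It is not inverted there, while \<open>y\<close> has an inversion, so
    \<open>no_common_backedge\<close> applies. Edges leaving the block therefore follow the order of
    the indices.\<close>
  have old: "\<not> old x t" if x: "x \<in> {b..a}" and t: "t \<in> {1..n}" "t \<notin> {b..a}" for x t
  proof -
    obtain y where y: "\<pi> y = x" "y \<in> {1..n}" using pre[of x] x assms(1,2) by auto
    obtain s where s: "\<pi> s = t" "s \<in> {1..n}" using pre[of t] t by auto
    have yb: "y \<in> {b..a}" using y x low high by (metis atLeastAtMost_iff not_le)
    obtain p where p: "inverted \<pi> y p" using inv yb by blast
    have "s \<notin> {b..a}" using blk s(1) t(2) by metis
    then consider "s < b" | "a < s" by force
    then have "\<not> inverted \<pi> y s \<and> y \<noteq> s"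
    proof cases
      case 1
      then show ?thesis using low yb x y(1) unfolding inverted_def by fastforce
    next
      case 2
      then show ?thesis using high yb x y(1) unfolding inverted_def by fastforce
    qed
    then show ?thesis using no_common_backedge[OF y(2) s(2) _ _ p] y(1) s(1) by blast
  qed
  show "(\<forall>x\<in>v ` {b..a}. E u x) \<or> (\<forall>x\<in>v ` {b..a}. E x u)" if "u \<in> V - v ` {b..a}" for u
  proof -
    have "u \<in> v ` {1..n}" using that unfolding bij_betw_imp_surj_on[OF v_bij] by (rule DiffD1)
    then obtain t where t: "u = v t" "t \<in> {1..n}" by (rule imageE)
    have tb: "t \<notin> {b..a}" using that imageI[of t "{b..a}" v] t(1) by (metis DiffD2)
    have e: "E (v x) u \<longleftrightarrow> x < t" "E u (v x) \<longleftrightarrow> t < x" if x: "x \<in> {b..a}" for x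
    proof -
      have m: "x \<in> {1..n}" "x \<noteq> t" using x tb assms(1,2) by auto
      show "E (v x) u \<longleftrightarrow> x < t"
        using edge_iff_old[OF m(1) t(2) m(2)] old[OF x t(2) tb] t(1) by simp
      then show "E u (v x) \<longleftrightarrow> t < x" using edge_flip[OF m(1) t(2) m(2)] t(1) m(2) by auto
    qed
    show ?thesis
    proof (cases "t < b")
      case True
      then show ?thesis using e(2) by auto
    next
      case False
      then show ?thesis using e(1) tb by auto
    qed
  qed
qed

lemma homogeneous_singleton:
  assumes "x \<in> {1..n}"
  shows "homogeneous V E (v ` {x..x})"
proof -
  have "v x \<in> V" using v_bij assms by (auto simp: bij_betw_def)
  then show ?thesis using tour unfolding homogeneous_def tournament_def by auto
qed

text \<open>One argument serves the cycle and its inverse, which exchange \<open>pi1_pos\<close> and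
  \<open>pi2_pos\<close>. The index \<open>j\<close> runs along the path; \<open>p1\<close> gives
  places in the new ordering and \<open>p2\<close> in the old. As \<open>d1\<close> and
  \<open>d2\<close> differ, exactly the consecutive vertices are inverted.\<close>

lemma zigzag_block:
  assumes b: "1 \<le> b" "b \<le> a" "a \<le> n" and m: "m = a + 1 - b"
    and z1: "zigzag d1 m p1" and z2: "zigzag d2 m p2" and d: "d1 \<noteq> d2"
    and \<pi>: "\<And>j. j \<in> {1..m} \<Longrightarrow> \<pi> (b + p1 j - 1) = b + p2 j - 1"
  shows zigzag_block_ordering: "is_pi_ordering E (v ` {b..a}) m p2 (\<lambda>j. v (b + j - 1))"
    and zigzag_block_inverted: "2 \<le> m \<Longrightarrow> \<forall>x\<in>{b..a}. \<exists>p. inverted \<pi> x p"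
proof -
  define A where "A j = b + p1 j - 1" for j
  define B where "B j = b + p2 j - 1" for j
  have mem: "p1 j \<in> {1..m}" "p2 j \<in> {1..m}" if "j \<in> {1..m}" for j
    using that z1 z2 unfolding zigzag_def by blast+
  have less: "A i < A j \<longleftrightarrow> p1 i < p1 j" "B i < B j \<longleftrightarrow> p2 i < p2 j" for i j
    using b(1) unfolding A_def B_def by auto
  have AB: "A j \<in> {b..a}" "B j \<in> {b..a}" "A j \<in> {1..n}" "B j \<in> {1..n}" "\<pi> (A j) = B j" if "j \<in> {1..m}" for j
    using mem[OF that] b m \<pi>[OF that] unfolding A_def B_def by auto
  have far: "A i < A j" "B i < B j" if "1 \<le> i" "i + 2 \<le> j" "j \<le> m" for i j
    using z1 z2 that unfolding less zigzag_def by blast+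
  have near: "A i < A (Suc i) \<longleftrightarrow> odd i = d1" "B i < B (Suc i) \<longleftrightarrow> odd i = d2" if "1 \<le> i" "i < m" for i
    using z1 z2 that unfolding less zigzag_def by blast+
  have injA: "A i \<noteq> A j" and injB: "B i \<noteq> B j" if "i \<in> {1..m}" "j \<in> {1..m}" "i \<noteq> j" for i j
  proof -
    have "p1 i \<noteq> p1 j" "p2 i \<noteq> p2 j"
      using inj_on_eq_iff[OF bij_betw_imp_inj_on[OF zigzag_bij[OF z1]] that(1,2)]
        inj_on_eq_iff[OF bij_betw_imp_inj_on[OF zigzag_bij[OF z2]] that(1,2)] that(3) by simp_all
    then show "A i \<noteq> A j" "B i \<noteq> B j"
      using mem(1)[OF that(1)] mem(1)[OF that(2)] mem(2)[OF that(1)] mem(2)[OF that(2)]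
      unfolding A_def B_def by auto
  qed
  have inv: "inverted \<pi> (A i) (A (Suc i))" if i: "1 \<le> i" "i < m" for i
  proof -
    have m: "i \<in> {1..m}" "Suc i \<in> {1..m}" using i by auto
    show ?thesis using near[OF i] injA[OF m] injB[OF m] AB(5)[OF m(1)] AB(5)[OF m(2)] d
      unfolding inverted_def by (metis linorder_neqE_nat n_not_Suc_n not_less_iff_gr_or_eq)
  qed
  have inv': "inverted \<pi> x y \<longleftrightarrow> inverted \<pi> y x" for x y unfolding inverted_def by auto
  have ex_inv: "\<exists>p. inverted \<pi> (A i) p" if "i \<in> {1..m}" "2 \<le> m" for i
  proof (cases "i = m")
    case True
    have "inverted \<pi> (A (m - 1)) (A m)" using inv[of "m - 1"] that by simp
    then show ?thesis using inv' True by blast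
  next
    case False
    then show ?thesis using inv[of i] that by auto
  qed
  show "\<forall>x\<in>{b..a}. \<exists>p. inverted \<pi> x p" if "2 \<le> m"
  proof
    fix x assume x: "x \<in> {b..a}"
    let ?j = "p1 (x + 1 - b)"
    have xm: "x + 1 - b \<in> {1..m}" "b + (x + 1 - b) - 1 = x" using pos_offset[OF x] m by auto
    then have "?j \<in> {1..m}" "A ?j = x" using z1 unfolding zigzag_def A_def by auto
    then show "\<exists>p. inverted \<pi> x p" using ex_inv that by metis
  qed
  \<comment> \<open>Two consecutive inversions share a vertex, so they are not both backedges of the
    same ordering; each is a backedge of exactly one, hence they alternate.\<close>
  have col: "old (B (Suc i)) (B (Suc (Suc i))) \<longleftrightarrow> \<not> old (B i) (B (Suc i))"
    if i: "1 \<le> i" "Suc i < m" for i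
  proof -
    have m: "i \<in> {1..m}" "Suc i \<in> {1..m}" "Suc (Suc i) \<in> {1..m}" using i by auto
    have ne: "A i \<noteq> A (Suc (Suc i))" "B i \<noteq> B (Suc (Suc i))" using injA injB m by auto
    have "old (B i) (B (Suc i)) \<noteq> new (A i) (A (Suc i))"
      "old (B (Suc i)) (B (Suc (Suc i))) \<noteq> new (A (Suc i)) (A (Suc (Suc i)))"
      using inverted_iff[OF AB(3)[OF m(1)] AB(3)[OF m(2)] injA[OF m(1,2)]] inv[of i]
        inverted_iff[OF AB(3)[OF m(2)] AB(3)[OF m(3)] injA[OF m(2,3)]] inv[of "Suc i"] i
        AB(5)[OF m(1)] AB(5)[OF m(2)] AB(5)[OF m(3)] by auto
    then show ?thesis using ne old_unique new_unique backlinked_sym by metis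
  qed
  have col': "1 \<le> i \<Longrightarrow> i < m \<Longrightarrow> old (B i) (B (Suc i)) \<longleftrightarrow> (old (B 1) (B 2) = odd i)" for i
  proof (induction i)
    case (Suc i)
    show ?case
    proof (cases "i = 0")
      case True
      then show ?thesis by (simp add: numeral_2_eq_2)
    next
      case False
      then show ?thesis using Suc col[of i] by simp
    qed
  qed simp
  let ?u = "\<lambda>j. v (B j)"
  \<comment> \<open>Along the path, both the old order of consecutive vertices and the old backedges
    alternate with the parity of \<open>i\<close>. The parities cancel, so all these edges point the
    same way.\<close>
  have step: "E (?u i) (?u (Suc i)) \<longleftrightarrow> d2 \<noteq> old (B 1) (B 2)" if i: "1 \<le> i" "i < m" for i
  proof -
    have m: "i \<in> {1..m}" "Suc i \<in> {1..m}" using i by auto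
    show ?thesis
      using edge_iff_old[OF AB(4)[OF m(1)] AB(4)[OF m(2)] injB[OF m]] near(2)[OF i] col'[OF i] by auto
  qed
  \<comment> \<open>Vertices further apart are not inverted, and each has an inversion of its own,
    so their edge is no backedge.\<close>
  have jump: "E (?u i) (?u j)" if ij: "1 \<le> i" "i + 2 \<le> j" "j \<le> m" for i j
  proof -
    have m: "i \<in> {1..m}" "j \<in> {1..m}" "i \<noteq> j" "2 \<le> m" using ij by auto
    have "\<not> inverted \<pi> (A i) (A j)"
      using far[OF ij] AB(5)[OF m(1)] AB(5)[OF m(2)] unfolding inverted_def by auto
    then have "\<not> old (B i) (B j)"
      using no_common_backedge[OF AB(3)[OF m(1)] AB(3)[OF m(2)] injA[OF m(1,2,3)]] ex_inv[OF m(1,4)]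
        AB(5)[OF m(1)] AB(5)[OF m(2)] by auto
    then show ?thesis
      using edge_iff_old[OF AB(4)[OF m(1)] AB(4)[OF m(2)] injB[OF m(1,2,3)]] far(2)[OF ij] by auto
  qed
  have "standard_trans_ordering E m ?u \<or> P_ordering E m ?u"
  \<comment> \<open>This bit decides between the two tournaments: consecutive edges all point
    forward (transitive) or all backward (\<open>P_ordering\<close>).\<close>
  proof (cases "d2 = old (B 1) (B 2)")
    case False
    have "E (?u i) (?u j)" if "1 \<le> i \<and> i < j \<and> j \<le> m" for i j
      using that step[of i] False jump[of i j] by (cases "j = Suc i") auto
    then show ?thesis unfolding standard_trans_ordering_def by blast
  next
    case True
    have "E (?u i) (?u j) \<longleftrightarrow> i + 2 \<le> j \<or> i = j + 1"
      if ij: "i \<in> {1..m}" "j \<in> {1..m}" "i \<noteq> j" for i j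
    proof -
      have flip: "E (?u i) (?u j) \<longleftrightarrow> \<not> E (?u j) (?u i)"
        using edge_flip AB(4) injB ij by blast
      consider "j = Suc i" | "i = Suc j" | "i + 2 \<le> j" | "j + 2 \<le> i" using ij(3) by linarith
      then show ?thesis
        using ij flip step[of i] step[of j] jump[of i j] jump[of j i] True by cases auto
    qed
    then show ?thesis unfolding P_ordering_def by blast
  qed
  moreover have "bij_betw ?u {1..m} (v ` {b..a})"
  proof -
    have "bij_betw (\<lambda>j. b + j - 1) {1..m} {b..a}"
      by (rule bij_betw_byWitness[where f' = "\<lambda>x. x + 1 - b"]) (use b m in auto)
    moreover have "{b..a} \<subseteq> {1..n}" using b by auto
    with bij_betw_imp_inj_on[OF v_bij] have "bij_betw v {b..a} (v ` {b..a})"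
      by (intro inj_on_imp_bij_betw) (rule inj_on_subset)
    ultimately have "bij_betw (v \<circ> ((\<lambda>j. b + j - 1) \<circ> p2)) {1..m} (v ` {b..a})"
      using zigzag_bij[OF z2] bij_betw_trans by metis
    then show ?thesis by (simp add: comp_def B_def)
  qed
  moreover have "\<forall>k\<in>{1..m}. v (b + k - 1) = ?u (p2 k)"
    using z2 unfolding B_def zigzag_def by simp
  ultimately show "is_pi_ordering E (v ` {b..a}) m p2 (\<lambda>j. v (b + j - 1))"
    unfolding is_pi_ordering_def by (intro exI[of _ ?u]) blast
qed

lemma tau_block_inverted:
  assumes \<pi>: "\<forall>x\<in>{b..b + 3}. \<pi> x = tauX b x"
  shows "\<forall>x\<in>{b..b + 3}. \<exists>p. inverted \<pi> x p"
proof
  fix x assume x: "x \<in> {b..b + 3}"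
  have "inverted \<pi> x (tauX b x)"
    using \<pi> x unfolding inverted_def tauX_def by auto
  then show "\<exists>p. inverted \<pi> x p" ..
qed

lemma P_orderingI4:
  assumes "E (u 1) (u 3)" "E (u 1) (u 4)" "E (u 2) (u 4)" "E (u 2) (u 1)" "E (u 3) (u 2)" "E (u 4) (u 3)"
    "\<not> E (u 3) (u 1)" "\<not> E (u 4) (u 1)" "\<not> E (u 4) (u 2)" "\<not> E (u 1) (u 2)" "\<not> E (u 2) (u 3)" "\<not> E (u 3) (u 4)"
  shows "P_ordering E 4 u"
proof -
  have "{1..4 :: nat} = {1, 2, 3, 4}" by auto
  then show ?thesis using assms unfolding P_ordering_def by simp
qed

text \<open>The inversions form a 4-cycle on which old and new backedges alternate. The two
  alternations give the two admissible orderings of the four-vertex path tournament.\<close>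

lemma tau_block_ordering:
  assumes b: "1 \<le> b" "b + 3 \<le> n" and \<pi>: "\<forall>x\<in>{b..b + 3}. \<pi> x = tauX b x"
  shows "is_P_pi_ordering E (v ` {b..b + 3}) 4 (pi2_pos 4) (\<lambda>j. v (b + j - 1)) \<or>
    is_P_pi_ordering E (v ` {b..b + 3}) 4 pi21_pos (\<lambda>j. v (b + j - 1))"
proof -
  have four: "{1..4 :: nat} = {1, 2, 3, 4}" and block: "{b..b + 3} = {b, b + 1, b + 2, b + 3}" by auto
  have p: "\<pi> b = b + 2" "\<pi> (b + 1) = b + 3" "\<pi> (b + 2) = b" "\<pi> (b + 3) = b + 1"
    using \<pi> by (auto simp: tauX_def)
  have mem: "b \<in> {1..n}" "b + 1 \<in> {1..n}" "b + 2 \<in> {1..n}" "b + 3 \<in> {1..n}" using b by auto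
  have iv: "inverted \<pi> b (b + 2)" "inverted \<pi> b (b + 3)" "inverted \<pi> (b + 1) (b + 2)" "inverted \<pi> (b + 1) (b + 3)"
    "inverted \<pi> (b + 2) b"
    "\<not> inverted \<pi> b (b + 1)" "\<not> inverted \<pi> (b + 2) (b + 3)"
    using p unfolding inverted_def by auto
  have x: "old (b + 2) b \<noteq> new b (b + 2)" "old (b + 2) (b + 1) \<noteq> new b (b + 3)"
    "old (b + 3) b \<noteq> new (b + 1) (b + 2)" "old (b + 3) (b + 1) \<noteq> new (b + 1) (b + 3)"
    using inverted_iff[OF mem(1,3)] inverted_iff[OF mem(1,4)] inverted_iff[OF mem(2,3)]
      inverted_iff[OF mem(2,4)] iv p by auto
  \<comment> \<open>Since \<open>tauX\<close> exchanges the two halves, the old pair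
    \<open>b\<close>, \<open>b + 1\<close> has the new places \<open>b + 2\<close>,
    \<open>b + 3\<close>, and vice versa.\<close>
  have n12: "\<not> old b (b + 1)" and n34: "\<not> old (b + 2) (b + 3)"
    using no_common_backedge[OF mem(3,4) _ iv(7,5)] no_common_backedge[OF mem(1,2) _ iv(6,1)] p by auto
  have ne: "b \<noteq> b + 1" "b \<noteq> b + 2" "b \<noteq> b + 3" "b + 1 \<noteq> b + 2" "b + 1 \<noteq> b + 3" "b + 2 \<noteq> b + 3" by auto
  \<comment> \<open>Adjacent edges of the 4-cycle cannot be backedges of the same ordering.\<close>
  have c1: "old b (b + 2) \<longleftrightarrow> \<not> old (b + 1) (b + 2)" "old b (b + 2) \<longleftrightarrow> \<not> old b (b + 3)"
    "old (b + 1) (b + 3) \<longleftrightarrow> \<not> old b (b + 3)"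
    using x ne old_unique new_unique backlinked_sym by metis+
  have e: "E (v x) (v y) \<longleftrightarrow> \<not> old x y" "E (v y) (v x) \<longleftrightarrow> old x y"
    if "x \<in> {1..n}" "y \<in> {1..n}" "x < y" for x y
    using edge_iff_old[OF that(1,2)] edge_flip[OF that(1,2)] that(3) by auto
  note ee = e[OF mem(1,2)] e[OF mem(1,3)] e[OF mem(1,4)] e[OF mem(2,3)] e[OF mem(2,4)] e[OF mem(3,4)]
  have "{b..b + 3} \<subseteq> {1..n}" using b by auto
  with bij_betw_imp_inj_on[OF v_bij] have inj: "inj_on v {b..b + 3}" by (rule inj_on_subset)
  have bij: "bij_betw (\<lambda>j. v (q j)) {1..4} (v ` {b..b + 3})" if "bij_betw q {1..4} {b..b + 3}" for q
  proof -
    have "bij_betw v {b..b + 3} (v ` {b..b + 3})" using inj by (rule inj_on_imp_bij_betw)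
    then show ?thesis using bij_betw_trans[OF that] by (simp add: comp_def)
  qed
  have offset: "b + 1 - 1 = b" "b + 2 - 1 = b + 1" "b + 3 - 1 = b + 2" "b + 4 - 1 = b + 3" by auto
  show ?thesis
  proof (cases "old b (b + 2)")
    case True
    \<comment> \<open>Determined by \<open>?q (pi2_pos 4 k) = b + k - 1\<close>.\<close>
    let ?q = "\<lambda>j::nat. if j = 1 then b else if j = 2 then b + 2 else if j = 3 then b + 1 else b + 3"
    have "bij_betw ?q {1..4} {b..b + 3}" unfolding four block bij_betw_def inj_on_def by (intro conjI) (simp, auto)
    moreover have "P_ordering E 4 (\<lambda>j. v (?q j))"
      by (rule P_orderingI4) (use ee True c1 n12 n34 in simp_all)
    moreover have "\<forall>k\<in>{1..4}. v (b + k - 1) = v (?q (pi2_pos 4 k))"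
    proof -
      have "pi2_pos 4 1 = 1" "pi2_pos 4 2 = 3" "pi2_pos 4 3 = 2" "pi2_pos 4 4 = 4"
        by (simp_all add: pi2_pos_def)
      then show ?thesis unfolding four using offset by (simp add: add.commute)
    qed
    ultimately show ?thesis unfolding is_P_pi_ordering_def using bij[of ?q] by blast
  next
    case False
    \<comment> \<open>Determined by \<open>?q (pi21_pos k) = b + k - 1\<close>.\<close>
    let ?q = "\<lambda>j::nat. if j = 1 then b + 2 else if j = 2 then b else if j = 3 then b + 3 else b + 1"
    have "bij_betw ?q {1..4} {b..b + 3}" unfolding four block bij_betw_def inj_on_def by (intro conjI) (simp, auto)
    moreover have "P_ordering E 4 (\<lambda>j. v (?q j))"
      by (rule P_orderingI4) (use ee False c1 n12 n34 in simp_all)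
    moreover have "\<forall>k\<in>{1..4}. v (b + k - 1) = v (?q (pi21_pos k))"
      unfolding four pi21_pos_def using offset by (simp add: add.commute)
    ultimately show ?thesis unfolding is_P_pi_ordering_def using bij[of ?q] by blast
  qed
qed

lemma block_structure:
  assumes b: "1 \<le> b" "b \<le> a" "a \<le> n" and tau: "k = Tau \<longrightarrow> a + 1 - b = 4"
    and \<pi>: "\<forall>x\<in>{b..a}. \<pi> x = block_perm k b a x"
    and low: "\<forall>x<b. \<pi> x < b" and high: "\<forall>x>a. a < \<pi> x"
  shows "homogeneous V E (v ` {b..a}) \<and>
    trans_or_P E (v ` {b..a}) (a + 1 - b) \<and>
    (k = Sig \<longrightarrow> is_pi_ordering E (v ` {b..a}) (a + 1 - b) (pi2_pos (a + 1 - b)) (\<lambda>j. v (b + j - 1))) \<and>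
    (k = SigInv \<longrightarrow> is_pi_ordering E (v ` {b..a}) (a + 1 - b) (pi1_pos (a + 1 - b)) (\<lambda>j. v (b + j - 1))) \<and>
    (k = Tau \<longrightarrow> is_P_pi_ordering E (v ` {b..a}) 4 (pi2_pos 4) (\<lambda>j. v (b + j - 1)) \<or>
                  is_P_pi_ordering E (v ` {b..a}) 4 pi21_pos (\<lambda>j. v (b + j - 1)))"
proof -
  let ?m = "a + 1 - b"
  have blk: "\<forall>x\<in>{b..a}. \<pi> x \<in> {b..a}"
    using \<pi> permutes_in_image[OF block_perm_permutes] tau by metis
  \<comment> \<open>A single vertex is homogeneous by itself; a larger block needs an inversion at
    each of its positions.\<close>
  have hom: "homogeneous V E (v ` {b..a})" if "2 \<le> ?m \<Longrightarrow> \<forall>x\<in>{b..a}. \<exists>p. inverted \<pi> x p"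
  proof (cases "a = b")
    case True
    then show ?thesis using homogeneous_singleton b by auto
  next
    case False
    then show ?thesis using homogeneous_block[OF b(1,3) low high blk] that b by auto
  qed
  have pos: "b + pi1_pos ?m j - 1 \<in> {b..a}" "b + pi2_pos ?m j - 1 \<in> {b..a}" if "j \<in> {1..?m}" for j
    using pi1_pos_mem[OF that] pi2_pos_mem[OF that] by auto
  show ?thesis
  proof (cases k)
    case Sig
    have "\<pi> (b + pi1_pos ?m j - 1) = b + pi2_pos ?m j - 1" if "j \<in> {1..?m}" for j
      using \<pi> pos[OF that] sigmaX_pos_inv[OF that] Sig by (simp add: block_perm_def)
    note z = zigzag_block[OF b refl zigzag_pi1 zigzag_pi2 _ this]
    from z(1) have "is_pi_ordering E (v ` {b..a}) ?m (pi2_pos ?m) (\<lambda>j. v (b + j - 1))" by simp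
    moreover from this have "trans_or_P E (v ` {b..a}) ?m"
      unfolding is_pi_ordering_def trans_or_P_def by blast
    ultimately show ?thesis using hom z(2) Sig by simp
  next
    case SigInv
    have "\<pi> (b + pi2_pos ?m j - 1) = b + pi1_pos ?m j - 1" if "j \<in> {1..?m}" for j
    proof -
      have "inv (sigmaX b a) (b + pi2_pos ?m j - 1) = b + pi1_pos ?m j - 1"
        unfolding permutes_inv_eq[OF sigmaX_permutes] by (rule sigmaX_pos_inv[OF that])
      then show ?thesis using \<pi> pos[OF that] SigInv by (simp add: block_perm_def)
    qed
    note z = zigzag_block[OF b refl zigzag_pi2 zigzag_pi1 _ this]
    from z(1) have "is_pi_ordering E (v ` {b..a}) ?m (pi1_pos ?m) (\<lambda>j. v (b + j - 1))" by simp
    moreover from this have "trans_or_P E (v ` {b..a}) ?m"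
      unfolding is_pi_ordering_def trans_or_P_def by blast
    ultimately show ?thesis using hom z(2) SigInv by simp
  next
    case Tau
    then have a: "a = b + 3" and m: "?m = 4" using tau by auto
    have t: "\<forall>x\<in>{b..b + 3}. \<pi> x = tauX b x" using \<pi> Tau a by (simp add: block_perm_def)
    have o: "is_P_pi_ordering E (v ` {b..a}) 4 (pi2_pos 4) (\<lambda>j. v (b + j - 1)) \<or>
      is_P_pi_ordering E (v ` {b..a}) 4 pi21_pos (\<lambda>j. v (b + j - 1))"
      using tau_block_ordering[OF b(1) _ t] b(3) a by simp
    then have "trans_or_P E (v ` {b..a}) ?m"
      unfolding m is_P_pi_ordering_def trans_or_P_def by blast
    then show ?thesis using hom tau_block_inverted[OF t] o Tau a by simp
  qed
qed

end

theorem theorem5p4: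
  fixes V :: "'a set" and E :: "'a \<Rightarrow> 'a \<Rightarrow> bool" and n :: nat
    and v :: "nat \<Rightarrow> 'a" and \<pi> :: "nat \<Rightarrow> nat"
  assumes "tournament V E"
    and "card V = n"
    and "matching_ordering V E n v"
    and "\<pi> permutes {1..n}"
    and "matching_ordering V E n (v \<circ> \<pi>)"
  shows "\<exists>r (b :: nat \<Rightarrow> nat) (a :: nat \<Rightarrow> nat) (k :: nat \<Rightarrow> kind).
     r \<ge> 1 \<and> b 1 = 1 \<and> a r = n \<and>
     (\<forall>i\<in>{1..r}. b i \<le> a i) \<and>
     (\<forall>i\<in>{1..<r}. b (Suc i) = a i + 1) \<and>
     (\<forall>i\<in>{1..r}. k i = Tau \<longrightarrow> a i + 1 - b i = 4) \<and>
     \<pi> = foldr (\<lambda>i f. block_perm (k i) (b i) (a i) \<circ> f) [1..<Suc r] id \<and>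
     (\<forall>i\<in>{1..r}.
        homogeneous V E (v ` {b i..a i}) \<and>
        trans_or_P E (v ` {b i..a i}) (a i + 1 - b i) \<and>
        (k i = Sig \<longrightarrow> is_pi_ordering E (v ` {b i..a i}) (a i + 1 - b i)
                         (pi2_pos (a i + 1 - b i)) (\<lambda>j. v (b i + j - 1))) \<and>
        (k i = SigInv \<longrightarrow> is_pi_ordering E (v ` {b i..a i}) (a i + 1 - b i)
                         (pi1_pos (a i + 1 - b i)) (\<lambda>j. v (b i + j - 1))) \<and>
        (k i = Tau \<longrightarrow> is_P_pi_ordering E (v ` {b i..a i}) 4 (pi2_pos 4) (\<lambda>j. v (b i + j - 1)) \<or>
                       is_P_pi_ordering E (v ` {b i..a i}) 4 pi21_pos (\<lambda>j. v (b i + j - 1))))"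
proof -
  interpret two_matching_orderings V E n v \<pi>
    using assms by unfold_locales
  have "card V > 0" using assms(1) by (simp add: tournament_def card_gt_0_iff)
  then have "1 \<le> n" using assms(2) by simp
  \<comment> \<open>The partition comes from sparseness alone; the tournament returns block by block
    in \<open>block_structure\<close>.\<close>
  from interval_decomposition_exists[OF assms(4) sparse_\<pi> this] obtain r b a k
    where D: "interval_decomposition \<pi> 1 n r b a k" by blast
  note R = interval_decompositionD[OF D]
  have le: "\<forall>i\<in>{1..r}. b i \<le> a i" using R(4) by blast
  show ?thesis
    by (rule exI[of _ r], rule exI[of _ b], rule exI[of _ a], rule exI[of _ k],
        intro conjI R(1-3,5-7) le, rule ballI, rule block_structure)
      (use R(4,6,8) in simp_all)
qed

end
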